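(* Let $a, b, n$ be real numbers with $a < \frac{2n+1}{4}$, such that all Pochhammer symbols and quotients appearing below are defined. For integers $k \ge 0$ let $$F(n,k) := \frac{(a)_{k+b}^4}{(1+n-a)_{k+b}^4}\,(n+2k+2b),$$ and for integers $j \ge 0$ let $$\mathcal{R}(n,j) := \frac{(n-2a+1)^5}{(2n-4a+1)(2n-4a+2j+1)(n-a+1)^4}\,\big(10a^2-8ab-14aj-14an-6a+2b^2+6bj+6bn+2b+5j^2+10jn+4j+5n^2+4n+1\big).$$ Then $$\sum_{k=0}^{\infty} F(n,k) = \sum_{j=0}^{\infty} \left(-\frac14\right)^{j} \frac{(n-2a+2)_{j-1}^5}{\left(n-2a+\frac32\right)_{j-1}\,(n-a+2)_{j-1}^4}\cdot\frac{(a)_b^4}{(n-a+j+1)_b^4}\,\mathcal{R}(n,j).$$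
   Context: The Pochhammer symbol is defined by $(x)_k := \frac{\Gamma(x+k)}{\Gamma(x)}$, where $\Gamma$ is the Gamma function and $k$ need not be a nonnegative integer; in particular $(x)_{-1} = \frac{1}{x-1}$. The notation $(x)_k^m$ means $\big((x)_k\big)^m$. *)

theory Defs
  imports "HOL-Analysis.Analysis"
begin

(* The library function pochhammer takes a natural number as its index; here the index is real. *)
definition poch :: "real \<Rightarrow> real \<Rightarrow> real" where
  "poch x k = Gamma (x + k) / Gamma x"

(* Gamma is totalised with value 0 at its poles, the nonpositive integers. poch is meaningful
   where neither of its two Gamma values is taken at a pole. *)
definition poch_defined :: "real \<Rightarrow> real \<Rightarrow> bool" where
  "poch_defined x k \<longleftrightarrow> x \<notin> \<int>\<^sub>\<le>\<^sub>0 \<and> x + k \<notin> \<int>\<^sub>\<le>\<^sub>0"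

definition F :: "real \<Rightarrow> real \<Rightarrow> real \<Rightarrow> nat \<Rightarrow> real" where
  "F a b n k =
     poch a (real k + b) ^ 4 / poch (1 + n - a) (real k + b) ^ 4 * (n + 2 * real k + 2 * b)"

definition R :: "real \<Rightarrow> real \<Rightarrow> real \<Rightarrow> nat \<Rightarrow> real" where
  "R a b n j =
     (n - 2*a + 1) ^ 5
       / ((2*n - 4*a + 1) * (2*n - 4*a + 2 * real j + 1) * (n - a + 1) ^ 4)
     * (10 * a^2 - 8*a*b - 14 * a * real j - 14*a*n - 6*a + 2 * b^2 + 6 * b * real j + 6*b*n
        + 2*b + 5 * (real j)^2 + 10 * real j * n + 4 * real j + 5 * n^2 + 4*n + 1)"

lemma poch_nonzero: "poch_defined x k \<Longrightarrow> poch x k \<noteq> 0"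
  by (simp add: poch_def poch_defined_def Gamma_eq_zero_iff)

lemma poch_minus_one:
  assumes "poch_defined x (-1)"
  shows "poch x (-1) = 1 / (x - 1)"
proof -
  have x1: "x - 1 \<notin> \<int>\<^sub>\<le>\<^sub>0" and x: "x \<notin> \<int>\<^sub>\<le>\<^sub>0"
    using assms by (auto simp: poch_defined_def)
  have "Gamma x = (x - 1) * Gamma (x - 1)"
    using Gamma_plus1[OF x1] by simp
  moreover have "Gamma (x - 1) \<noteq> 0" using x1 by (simp add: Gamma_eq_zero_iff)
  ultimately show ?thesis by (simp add: poch_def)
qed

lemma nonpos_Ints_add_nat: "x \<notin> \<int>\<^sub>\<le>\<^sub>0 \<Longrightarrow> x + real m \<notin> \<int>\<^sub>\<le>\<^sub>0"
proof
  assume x: "x \<notin> \<int>\<^sub>\<le>\<^sub>0" and "x + real m \<in> \<int>\<^sub>\<le>\<^sub>0"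
  then have "x + real m - real m \<in> \<int>\<^sub>\<le>\<^sub>0"
    by (intro nonpos_Ints_diff_Nats) auto
  with x show False by simp
qed

lemma nonpos_Ints_pos: "0 < x \<Longrightarrow> (x::real) \<notin> \<int>\<^sub>\<le>\<^sub>0"
  by (auto elim!: nonpos_Ints_cases)

(* If the Pochhammer symbols in F are defined, then so are all the other Pochhammer symbols
   and all the quotients in the identity. *)
lemma remaining_terms_defined:
  assumes "a < (2*n + 1) / 4"
    and "\<And>k::nat. poch_defined a (real k + b)"
    and "\<And>k::nat. poch_defined (1 + n - a) (real k + b)"
  shows "poch_defined (n - 2*a + 2) (real j - 1)"
    and "poch_defined (n - 2*a + 3/2) (real j - 1)"
    and "poch_defined (n - a + 2) (real j - 1)"
    and "poch_defined a b"
    and "poch_defined (n - a + real j + 1) b"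
    and "2*n - 4*a + 1 \<noteq> 0" "2*n - 4*a + 2 * real j + 1 \<noteq> 0" "n - a + 1 \<noteq> 0"
proof -
  have p: "2*n - 4*a + 1 > 0" using assms(1) by (simp add: field_simps)
  show "poch_defined (n - 2*a + 2) (real j - 1)" "poch_defined (n - 2*a + 3/2) (real j - 1)"
    unfolding poch_defined_def using p by (auto intro!: nonpos_Ints_pos)
  show "2*n - 4*a + 1 \<noteq> 0" "2*n - 4*a + 2 * real j + 1 \<noteq> 0" using p by linarith+
  show "poch_defined a b" using assms(2)[of 0] by simp
  have q: "1 + n - a \<notin> \<int>\<^sub>\<le>\<^sub>0" "1 + n - a + b \<notin> \<int>\<^sub>\<le>\<^sub>0"
    using assms(3)[of 0] by (auto simp: poch_defined_def)
  show "n - a + 1 \<noteq> 0" using q(1) by (metis add.commute add_diff_eq zero_in_nonpos_Ints)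
  have "n - a + 2 = 1 + n - a + real 1" "n - a + 2 + (real j - 1) = 1 + n - a + real j" by auto
  then show "poch_defined (n - a + 2) (real j - 1)"
    unfolding poch_defined_def using nonpos_Ints_add_nat[OF q(1)] by metis
  have "n - a + real j + 1 = 1 + n - a + real j"
    "n - a + real j + 1 + b = 1 + n - a + b + real j" by auto
  then show "poch_defined (n - a + real j + 1) b"
    unfolding poch_defined_def using nonpos_Ints_add_nat[OF q(1)] nonpos_Ints_add_nat[OF q(2)] by metis
qed

end

theory Submission
  imports Defs "HOL-Real_Asymp.Real_Asymp"
begin

text \<open>
  The identity is an accelerated form of its left-hand side, produced by a Wilf--Zeilberger
  argument. Up to the constant \<open>(\<Gamma>(1+n-a)/\<Gamma>(a))\<^sup>4\<close>, the term \<open>F(n,k)\<close> depends on \<open>b\<close>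
  and \<open>k\<close> only through \<open>y = b + k\<close>: it is
  \<open>t(n,y) = (\<Gamma>(a+y)/\<Gamma>(n-a+y+1))\<^sup>4 (n+2y)\<close>. Write \<open>T(n)\<close> for the sum of
  \<open>t(n, b+k)\<close> over \<open>k \<ge> 0\<close> and \<open>m = n - 2a\<close>, so that the hypothesis says \<open>m > -1/2\<close>.
  The sum of two neighbouring terms, suitably weighted, telescopes in \<open>y\<close>:
  \<open>t(n,y) + c(n) t(n+1,y) = G(n,y) - G(n,y+1)\<close> with \<open>c(n) = (m+1)\<^sup>5 / (2(2m+1))\<close>
  (\<open>summand_contiguous\<close>). The certificate \<open>G\<close> is the Gamma quotient of \<open>t\<close> times the quadratic
  polynomial that occurs in \<open>\<R>\<close>; dividing by Gamma factors turns the relation into a polynomial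
  identity.

  A Gamma quotient \<open>\<Gamma>(x+k)/\<Gamma>(y+k)\<close> decays like \<open>k\<close> to the power \<open>x-y\<close>, here \<open>-(m+1)\<close>. So
  \<open>t\<close> has order \<open>1 - 4(m+1) < -1\<close> and is summable, while \<open>G\<close> has order \<open>2 - 4(m+1) < 0\<close>
  and vanishes at infinity; both conditions are equivalent to \<open>m > -1/2\<close>. Summing over \<open>k\<close> gives
  \<open>T(n) = G(n,b) - c(n) T(n+1)\<close> (\<open>well_poised_sum_recurrence\<close>).

  Iterating, \<open>T(n)\<close> becomes the sum of \<open>w(j) G(n+j,b)\<close> over \<open>j < J\<close> plus the remainder
  \<open>w(J) T(n+J)\<close>, where \<open>w(j) = (-1)\<^sup>j c(n) \<dots> c(n+j-1)\<close> is the quotient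
  \<open>(-1/4)\<^sup>j (m+1)\<^sub>j\<^sup>5 / (m+1/2)\<^sub>j\<close>. Each term of \<open>T(n+J)\<close> is that of \<open>T(n)\<close> divided by
  the fourth power of a Pochhammer symbol of length \<open>J\<close>, apart from the linear factor. This
  balances the growth \<open>J!\<^sup>4\<close> in \<open>w(J)\<close> and leaves a geometric decay of ratio \<open>1/4\<close>, uniformly
  in \<open>k\<close> (\<open>remainder_tendsto_0\<close>). The terms \<open>w(j) G(n+j,b)\<close> are those of the right-hand side
  once its index shifts by \<open>-1\<close> are undone (\<open>series_term_eq\<close>).
\<close>

section \<open>The contiguous relation in \<open>n\<close>\<close>

definition summand :: "real \<Rightarrow> real \<Rightarrow> real \<Rightarrow> real" where
  "summand a n y = (Gamma (a + y) / Gamma (n - a + y + 1)) ^ 4 * (n + 2 * y)"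

definition cert_poly :: "real \<Rightarrow> real \<Rightarrow> real \<Rightarrow> real" where
  "cert_poly a n y = 10 * a^2 - 8*a*y - 14*a*n - 6*a + 2 * y^2 + 6*y*n + 2*y + 5 * n^2 + 4*n + 1"

text \<open>
  At \<open>y = b + k\<close> this is the function whose differences in \<open>k\<close> produce the contiguous relation
  of Wilf and Zeilberger; only its value at \<open>y = b\<close> survives the summation.
\<close>
definition certificate :: "real \<Rightarrow> real \<Rightarrow> real \<Rightarrow> real" where
  "certificate a n y =
     (Gamma (a + y) / Gamma (n - a + y + 1)) ^ 4 * cert_poly a n y / (2 * (2*n - 4*a + 1))"

text \<open>
  This is the contiguous relation below multiplied by \<open>2(2n-4a+1)\<close> and by
  \<open>(\<Gamma>(n-a+y+2)/\<Gamma>(a+y))\<^sup>4\<close>. The polynomial \<open>cert_poly\<close> depends only on \<open>n-2a\<close> and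
  \<open>a+y\<close>, as do both sides.
\<close>
lemma certificate_poly_identity:
  "2 * (2*n - 4*a + 1) * (n - a + y + 1)^4 * (n + 2*y) + (n - 2*a + 1)^5 * (n + 1 + 2*y)
   = (n - a + y + 1)^4 * cert_poly a n y - (a + y)^4 * cert_poly a n (y + 1)"
  unfolding cert_poly_def by algebra

text \<open>
  The step \<open>n \<rightarrow> n + 1\<close> divides the Gamma quotient by \<open>n-a+y+1\<close>, and \<open>y \<rightarrow> y + 1\<close> multiplies it
  by \<open>(a+y)/(n-a+y+1)\<close>. All four terms are therefore rational multiples of one quantity, and
  comparing the factors leaves \<open>certificate_poly_identity\<close>.
\<close>
lemma summand_contiguous:
  assumes "a + y \<notin> \<int>\<^sub>\<le>\<^sub>0" "n - a + y + 1 \<notin> \<int>\<^sub>\<le>\<^sub>0" "2*n - 4*a + 1 \<noteq> 0"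
  shows "summand a n y + (n - 2*a + 1)^5 / (2 * (2*n - 4*a + 1)) * summand a (n + 1) y
         = certificate a n y - certificate a n (y + 1)"
proof -
  define X D where "X = n - a + y + 1" and "D = 2*n - 4*a + 1"
  define g where "g = (Gamma (a + y) / Gamma X) ^ 4"
  have X: "X \<noteq> 0" and D: "D \<noteq> 0" using assms by (auto simp: X_def D_def)
  have GX: "Gamma (X + 1) = X * Gamma X"
    unfolding X_def by (rule Gamma_plus1) (fact assms(2))
  have GA: "Gamma (a + y + 1) = (a + y) * Gamma (a + y)"
    by (rule Gamma_plus1) (fact assms(1))
  have s0: "summand a n y = g * (n + 2*y)" and c0: "certificate a n y = g * cert_poly a n y / (2*D)"
    by (simp_all add: summand_def certificate_def g_def X_def D_def)
  have shift: "n + 1 - a + y + 1 = X + 1" "n - a + (y + 1) + 1 = X + 1" "a + (y + 1) = a + y + 1"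
    by (simp_all add: X_def)
  have s1: "summand a (n + 1) y = g / X^4 * (n + 1 + 2*y)"
    unfolding summand_def shift GX by (simp add: g_def power_divide power_mult_distrib)
  have c1: "certificate a n (y + 1) = g * (a + y)^4 / X^4 * cert_poly a n (y + 1) / (2*D)"
    unfolding certificate_def shift GX GA
    by (simp add: g_def power_divide power_mult_distrib D_def mult_ac)
  have "2 * D * X^4 * (n + 2*y) + (n - 2*a + 1)^5 * (n + 1 + 2*y)
   = X^4 * cert_poly a n y - (a + y)^4 * cert_poly a n (y + 1)"
    unfolding D_def X_def by (rule certificate_poly_identity)
  then have "g / (2 * D * X^4) * (2 * D * X^4 * (n + 2*y) + (n - 2*a + 1)^5 * (n + 1 + 2*y))
   = g / (2 * D * X^4) * (X^4 * cert_poly a n y - (a + y)^4 * cert_poly a n (y + 1))"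
    by simp
  then show ?thesis
    using X D unfolding s0 s1 c0 c1 D_def[symmetric] by (simp add: field_simps)
qed

section \<open>Decay of Gamma quotients\<close>

text \<open>
  Gauss's product \<open>\<Gamma>(z) = lim (k-1)! k\<^sup>z / (z)\<^sub>k\<close>, taken at \<open>x\<close> and at \<open>y\<close>: the factorials
  cancel in the quotient, and \<open>(z)\<^sub>k = \<Gamma>(z+k)/\<Gamma>(z)\<close>.
\<close>
lemma Gamma_quotient_asymptotic:
  fixes x y :: real
  assumes "x \<notin> \<int>\<^sub>\<le>\<^sub>0" "y \<notin> \<int>\<^sub>\<le>\<^sub>0"
  shows "(\<lambda>k. Gamma (x + real k) / Gamma (y + real k) * real k powr (y - x)) \<longlonglongrightarrow> 1"
proof -
  have nz: "Gamma x \<noteq> 0" "Gamma y \<noteq> 0" using assms by (auto simp: Gamma_eq_zero_iff)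
  have "(\<lambda>k. (Gamma x / Gamma y) * (Gamma_series' y k / Gamma_series' x k))
         \<longlonglongrightarrow> (Gamma x / Gamma y) * (Gamma y / Gamma x)"
    by (intro tendsto_intros Gamma_series'_LIMSEQ nz)
  moreover have "\<forall>\<^sub>F k in sequentially.
      (Gamma x / Gamma y) * (Gamma_series' y k / Gamma_series' x k)
      = Gamma (x + real k) / Gamma (y + real k) * real k powr (y - x)"
    using eventually_gt_at_top[of 0]
  proof eventually_elim
    case (elim k)
    have "pochhammer x k \<noteq> 0" "pochhammer y k \<noteq> 0"
      using assms by (auto simp: pochhammer_eq_0_iff)
    moreover have "Gamma (x + real k) = pochhammer x k * Gamma x"
      "Gamma (y + real k) = pochhammer y k * Gamma y"
      using pochhammer_Gamma[OF assms(1), of k] pochhammer_Gamma[OF assms(2), of k] nz by auto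
    moreover have "real k powr (y - x) = exp (y * ln k) / exp (x * ln k)"
      using elim by (simp add: powr_def left_diff_distrib exp_diff)
    ultimately show ?case
      using nz by (simp add: Gamma_series'_def field_simps)
  qed
  ultimately show ?thesis
    using nz by (auto elim: Lim_transform_eventually)
qed

lemma Gamma_quotient_power4_bigo:
  fixes x y :: real
  assumes "x \<notin> \<int>\<^sub>\<le>\<^sub>0" "y \<notin> \<int>\<^sub>\<le>\<^sub>0"
  shows "(\<lambda>k. (Gamma (x + real k) / Gamma (y + real k)) ^ 4) \<in> O(\<lambda>k. real k powr (4 * (x - y)))"
proof (rule bigoI_tendsto)
  have "(\<lambda>k. (Gamma (x + real k) / Gamma (y + real k) * real k powr (y - x)) ^ 4) \<longlonglongrightarrow> 1 ^ 4"
    by (intro tendsto_intros Gamma_quotient_asymptotic assms)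
  moreover have "\<forall>\<^sub>F k in sequentially.
      (Gamma (x + real k) / Gamma (y + real k) * real k powr (y - x)) ^ 4
      = (Gamma (x + real k) / Gamma (y + real k)) ^ 4 / real k powr (4 * (x - y))"
    using eventually_gt_at_top[of 0]
  proof eventually_elim
    case (elim k)
    have "(real k powr (y - x)) ^ 4 = real k powr (4 * (y - x))"
      using elim by (simp add: powr_power mult.commute)
    also have "\<dots> = inverse (real k powr (4 * (x - y)))"
      by (simp add: powr_minus[symmetric])
    finally show ?case by (simp add: power_mult_distrib divide_inverse)
  qed
  ultimately show "(\<lambda>k. (Gamma (x + real k) / Gamma (y + real k)) ^ 4 / real k powr (4 * (x - y))) \<longlonglongrightarrow> 1 ^ 4"
    by (rule Lim_transform_eventually)
  show "\<forall>\<^sub>F k in sequentially. real k powr (4 * (x - y)) \<noteq> 0"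
    using eventually_gt_at_top[of 0] by eventually_elim auto
qed

text \<open>
  The condition \<open>y - x > 1/2\<close> makes \<open>4(x-y) + 1 < -1\<close>. The linear factor is left general because
  the remainder estimate needs it in the form \<open>\<bar>n+2b+2k\<bar> + 1\<close>.
\<close>
lemma summable_Gamma_quotient_power4:
  fixes x y :: real
  assumes "x \<notin> \<int>\<^sub>\<le>\<^sub>0" "y \<notin> \<int>\<^sub>\<le>\<^sub>0" "y - x > 1/2" and h: "h \<in> O(\<lambda>k. real k)"
  shows "summable (\<lambda>k. (Gamma (x + real k) / Gamma (y + real k)) ^ 4 * h k)"
proof (rule summable_comparison_test_bigo)
  show "summable (\<lambda>k. norm (real k powr (4 * (x - y) + 1)))"
    using assms by (simp add: summable_real_powr_iff)
  have "(\<lambda>k. (Gamma (x + real k) / Gamma (y + real k)) ^ 4 * h k)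
      \<in> O(\<lambda>k. real k powr (4 * (x - y)) * real k)"
    by (rule landau_o.big.mult[OF Gamma_quotient_power4_bigo h]) fact+
  also have "(\<lambda>k. real k powr (4 * (x - y)) * real k) = (\<lambda>k. real k powr (4 * (x - y) + 1))"
    by (auto simp: powr_add)
  finally show "(\<lambda>k. (Gamma (x + real k) / Gamma (y + real k)) ^ 4 * h k)
      \<in> O(\<lambda>k. real k powr (4 * (x - y) + 1))" .
qed

lemma tendsto_Gamma_quotient_power4:
  fixes x y :: real
  assumes "x \<notin> \<int>\<^sub>\<le>\<^sub>0" "y \<notin> \<int>\<^sub>\<le>\<^sub>0" "y - x > 1/2" and h: "h \<in> O(\<lambda>k. real k ^ 2)"
  shows "(\<lambda>k. (Gamma (x + real k) / Gamma (y + real k)) ^ 4 * h k) \<longlonglongrightarrow> 0"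
proof -
  have "(\<lambda>k. (Gamma (x + real k) / Gamma (y + real k)) ^ 4 * h k)
      \<in> O(\<lambda>k. real k powr (4 * (x - y)) * real k ^ 2)"
    by (rule landau_o.big.mult[OF Gamma_quotient_power4_bigo h]) fact+
  also have "(\<lambda>k. real k powr (4 * (x - y)) * real k ^ 2) = (\<lambda>k. real k powr (4 * (x - y) + 2))"
    by (auto simp: powr_add)
  also have "(\<lambda>k. real k powr (4 * (x - y) + 2)) \<in> o(\<lambda>k. 1)"
  proof (rule smalloI_tendsto)
    have "(\<lambda>k. real k powr (4 * (x - y) + 2)) \<longlonglongrightarrow> 0"
      using assms by (intro tendsto_neg_powr filterlim_real_sequentially) simp
    then show "(\<lambda>k. real k powr (4 * (x - y) + 2) / 1) \<longlonglongrightarrow> 0" by simp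
  qed auto
  finally show ?thesis by (auto dest: smalloD_tendsto)
qed

section \<open>One step of the recurrence\<close>

definition well_poised_sum :: "real \<Rightarrow> real \<Rightarrow> real \<Rightarrow> real" where
  "well_poised_sum a b n = (\<Sum>k. summand a n (b + real k))"

lemma summable_summand:
  assumes "a < (2*n + 1) / 4" "a + b \<notin> \<int>\<^sub>\<le>\<^sub>0" "n - a + b + 1 \<notin> \<int>\<^sub>\<le>\<^sub>0"
  shows "summable (\<lambda>k. summand a n (b + real k))"
proof -
  have "summable (\<lambda>k. (Gamma (a + b + real k) / Gamma (n - a + b + 1 + real k)) ^ 4
                       * (n + 2*b + 2 * real k))"
    using assms by (intro summable_Gamma_quotient_power4) (auto simp: field_simps, real_asymp)
  then show ?thesis by (simp add: summand_def algebra_simps)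
qed

lemma certificate_tendsto_0:
  assumes "a < (2*n + 1) / 4" "a + b \<notin> \<int>\<^sub>\<le>\<^sub>0" "n - a + b + 1 \<notin> \<int>\<^sub>\<le>\<^sub>0"
  shows "(\<lambda>k. certificate a n (b + real k)) \<longlonglongrightarrow> 0"
proof -
  have "(\<lambda>k. cert_poly a n (b + real k)) \<in> O(\<lambda>k. real k ^ 2)"
    unfolding cert_poly_def by real_asymp
  then have "(\<lambda>k. (Gamma (a + b + real k) / Gamma (n - a + b + 1 + real k)) ^ 4
               * cert_poly a n (b + real k)) \<longlonglongrightarrow> 0"
    using assms by (intro tendsto_Gamma_quotient_power4) (auto simp: field_simps)
  then have "(\<lambda>k. (Gamma (a + b + real k) / Gamma (n - a + b + 1 + real k)) ^ 4
               * cert_poly a n (b + real k) / (2 * (2*n - 4*a + 1))) \<longlonglongrightarrow> 0"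
    by (rule tendsto_divide_zero)
  moreover have "a + (b + real k) = a + b + real k"
    "n - a + (b + real k) + 1 = n - a + b + 1 + real k" for k
    by simp_all
  ultimately show ?thesis by (simp only: certificate_def)
qed

text \<open>
  Summation of \<open>summand_contiguous\<close> over \<open>y = b + k\<close>. The hypotheses are stable under
  \<open>n \<rightarrow> n + 1\<close>, so both series on the left converge.
\<close>
lemma well_poised_sum_recurrence:
  assumes "a < (2*n + 1) / 4" "a + b \<notin> \<int>\<^sub>\<le>\<^sub>0" "n - a + b + 1 \<notin> \<int>\<^sub>\<le>\<^sub>0"
  shows "well_poised_sum a b n = certificate a n b - (n - 2*a + 1)^5 / (2 * (2*n - 4*a + 1)) * well_poised_sum a b (n + 1)"
proof -
  let ?c = "(n - 2*a + 1)^5 / (2 * (2*n - 4*a + 1))"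
  have n1: "a < (2*(n + 1) + 1) / 4" "n + 1 - a + b + 1 \<notin> \<int>\<^sub>\<le>\<^sub>0"
    using assms(1) nonpos_Ints_add_nat[OF assms(3), of 1] by (auto simp: algebra_simps)
  have eq: "summand a n (b + real k) + ?c * summand a (n + 1) (b + real k)
      = certificate a n (b + real k) - certificate a n (b + real (Suc k))" for k
  proof -
    have "summand a n (b + real k) + ?c * summand a (n + 1) (b + real k)
      = certificate a n (b + real k) - certificate a n ((b + real k) + 1)"
      using assms(1) nonpos_Ints_add_nat[OF assms(2), of k] nonpos_Ints_add_nat[OF assms(3), of k]
      by (intro summand_contiguous) (auto simp: algebra_simps)
    then show ?thesis by (simp add: algebra_simps)
  qed
  have "(\<lambda>k. summand a n (b + real k) + ?c * summand a (n + 1) (b + real k)) sums (well_poised_sum a b n + ?c * well_poised_sum a b (n + 1))"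
    unfolding well_poised_sum_def
    by (intro sums_add sums_mult summable_sums summable_summand assms n1)
  moreover have "(\<lambda>k. certificate a n (b + real k) - certificate a n (b + real (Suc k))) sums (certificate a n b - 0)"
    using telescope_sums'[OF certificate_tendsto_0[OF assms]] by simp
  ultimately have "well_poised_sum a b n + ?c * well_poised_sum a b (n + 1) = certificate a n b"
    unfolding eq using sums_unique2 by fastforce
  then show ?thesis by simp
qed

section \<open>Iteration and the remainder\<close>

text \<open>
  The signed product of the coefficients of the first \<open>j\<close> recurrence steps, with \<open>m = n - 2a\<close>.
\<close>
definition weight :: "real \<Rightarrow> nat \<Rightarrow> real" where
  "weight m j = (-1/4) ^ j * pochhammer (m + 1) j ^ 5 / pochhammer (m + 1/2) j"

lemma weight_Suc:
  assumes "m > -1/2"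
  shows "weight m (Suc j) = - ((m + real j + 1)^5 / (2 * (2 * (m + real j) + 1))) * weight m j"
proof -
  have "pochhammer (m + 1/2) j \<noteq> 0"
    using pochhammer_pos[of "m + 1/2" j] assms by simp
  moreover have "2 * (m + real j) + 1 > 0"
    using assms of_nat_0_le_iff[of j, where ?'a = real] by simp
  moreover have "m + 1/2 + real j = (2 * (m + real j) + 1) / 2" by simp
  ultimately show ?thesis
    by (simp add: weight_def pochhammer_Suc power_mult_distrib divide_simps) (simp add: algebra_simps)
qed

lemma well_poised_sum_iterated:
  assumes "a < (2*n + 1) / 4" "a + b \<notin> \<int>\<^sub>\<le>\<^sub>0" "n - a + b + 1 \<notin> \<int>\<^sub>\<le>\<^sub>0"
  shows "well_poised_sum a b n = (\<Sum>j<J. weight (n - 2*a) j * certificate a (n + real j) b)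
                   + weight (n - 2*a) J * well_poised_sum a b (n + real J)"
proof (induction J)
  case 0
  show ?case by (simp add: weight_def)
next
  case (Suc J)
  define c where "c = (n + real J - 2*a + 1)^5 / (2 * (2*(n + real J) - 4*a + 1))"
  have step: "well_poised_sum a b (n + real J) = certificate a (n + real J) b - c * well_poised_sum a b (n + real J + 1)"
    unfolding c_def
    using assms nonpos_Ints_add_nat[OF assms(3), of J]
    by (intro well_poised_sum_recurrence) (auto simp: algebra_simps)
  have weight: "weight (n - 2*a) (Suc J) = - c * weight (n - 2*a) J"
    using weight_Suc[of "n - 2*a" J] assms(1) by (simp add: c_def algebra_simps)
  have shift: "n + real (Suc J) = n + real J + 1" by simp
  show ?case
    using Suc.IH unfolding shift weight step sum.lessThan_Suc by (simp add: algebra_simps)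
qed

text \<open>
  The ratio of successive terms tends to \<open>1/4\<close> in absolute value: the coefficient of
  the recurrence grows like \<open>j\<^sup>4 / 4\<close>, and the next factor of the Pochhammer symbol enters the
  denominator with its fourth power.
  The factor \<open>j + 1\<close> provides for the growth of \<open>n + j + 2b + 2k\<close>.
\<close>
lemma weight_over_pochhammer_tendsto_0:
  fixes x :: real
  assumes m: "m > -1/2" and x: "x \<notin> \<int>\<^sub>\<le>\<^sub>0"
  shows "(\<lambda>j. weight m j / pochhammer x j ^ 4 * (real j + 1)) \<longlonglongrightarrow> 0"
proof -
  let ?f = "\<lambda>j. weight m j / pochhammer x j ^ 4 * (real j + 1)"
  let ?r = "\<lambda>j. \<bar>(m + real j + 1)^5 / (2 * (2 * (m + real j) + 1)) / (x + real j)^4 * (real j + 2) / (real j + 1)\<bar>"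
  have "?r \<longlonglongrightarrow> 1/4" by real_asymp
  then have "\<forall>\<^sub>F j in sequentially. ?r j < 1/2"
    by (rule order_tendstoD) simp
  then obtain N where N: "\<And>j. j \<ge> N \<Longrightarrow> ?r j < 1/2"
    by (auto simp: eventually_sequentially)
  have "summable ?f"
  proof (rule summable_ratio_test)
    show "(1/2::real) < 1" by simp
    fix j assume "j \<ge> N"
    have "?f (Suc j) = - ((m + real j + 1)^5 / (2 * (2 * (m + real j) + 1)) / (x + real j)^4
                          * (real j + 2) / (real j + 1)) * ?f j"
      unfolding weight_Suc[OF m]
      by (simp add: pochhammer_Suc power_mult_distrib) (simp add: ac_simps)
    then have "norm (?f (Suc j)) = ?r j * norm (?f j)"
      by (simp only: real_norm_def abs_mult abs_minus_cancel)
    also have "\<dots> \<le> 1/2 * norm (?f j)"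
      using N[OF \<open>j \<ge> N\<close>] by (intro mult_right_mono) auto
    finally show "norm (?f (Suc j)) \<le> 1/2 * norm (?f j)" .
  qed
  then show ?thesis by (rule summable_LIMSEQ_zero)
qed

text \<open>
  Once \<open>x + K > 0\<close>, the Pochhammer symbols increase with the shift \<open>k \<ge> K\<close>, so \<open>k = K\<close> is the
  worst case among those. The finitely many shifts \<open>k < K\<close>, at which the base point may be
  negative, are covered by adding their values. The bound is uniform in \<open>k\<close>, which reduces the
  remainder estimate to finitely many limits in \<open>j\<close>.
\<close>
lemma inverse_pochhammer_shift_bound:
  fixes x :: real
  shows "\<exists>K::nat. \<forall>k j.
           1 / pochhammer (x + real k) j ^ 4 \<le> (\<Sum>i\<le>K. 1 / pochhammer (x + real i) j ^ 4)"
proof -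
  obtain K :: nat where "-x < real K"
    using reals_Archimedean2 by blast
  then have K: "x + real K > 0" by linarith
  have "1 / pochhammer (x + real k) j ^ 4 \<le> (\<Sum>i\<le>K. 1 / pochhammer (x + real i) j ^ 4)" for k j
  proof -
    \<comment> \<open>The index of a summand that dominates the left-hand side.\<close>
    define i where "i = min k K"
    have "1 / pochhammer (x + real k) j ^ 4 \<le> 1 / pochhammer (x + real i) j ^ 4"
    proof (cases "k \<le> K")
      case False
      then have "pochhammer (x + real K) j \<le> pochhammer (x + real k) j"
        unfolding pochhammer_prod using K by (intro prod_mono) auto
      moreover have "pochhammer (x + real K) j > 0" by (rule pochhammer_pos) (fact K)
      ultimately show ?thesis
        using False by (auto simp: i_def intro!: divide_left_mono power_mono)
    qed (simp add: i_def)
    also have "\<dots> \<le> (\<Sum>i\<le>K. 1 / pochhammer (x + real i) j ^ 4)"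
      by (rule member_le_sum) (auto simp: i_def)
    finally show ?thesis .
  qed
  then show ?thesis by blast
qed

text \<open>
  With \<open>x = n-a+b+1\<close>, replacing \<open>n\<close> by \<open>n + j\<close> divides the Gamma quotient of the \<open>k\<close>-th term
  by \<open>(x+k)\<^sub>j\<close>. The uniform bound then separates the variables: the term of the remainder is at
  most \<open>E(j) M(k)\<close>, with \<open>E\<close> tending to 0 and \<open>M\<close> summable.
\<close>
lemma remainder_tendsto_0:
  assumes "a < (2*n + 1) / 4" "a + b \<notin> \<int>\<^sub>\<le>\<^sub>0" "n - a + b + 1 \<notin> \<int>\<^sub>\<le>\<^sub>0"
  shows "(\<lambda>j. weight (n - 2*a) j * well_poised_sum a b (n + real j)) \<longlonglongrightarrow> 0"
proof -
  define x where "x = n - a + b + 1"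
  define M where "M k = (Gamma (a + b + real k) / Gamma (x + real k)) ^ 4 * (\<bar>n + 2*b + 2 * real k\<bar> + 1)" for k
  obtain K :: nat where K:
    "\<And>k j. 1 / pochhammer (x + real k) j ^ 4 \<le> (\<Sum>i\<le>K. 1 / pochhammer (x + real i) j ^ 4)"
    using inverse_pochhammer_shift_bound[of x] by metis
  define E where "E j = \<bar>weight (n - 2*a) j\<bar> * (\<Sum>i\<le>K. 1 / pochhammer (x + real i) j ^ 4) * (real j + 1)" for j
  have x: "x + real k \<notin> \<int>\<^sub>\<le>\<^sub>0" for k
    unfolding x_def by (rule nonpos_Ints_add_nat) (fact assms(3))
  have M: "summable M"
    unfolding M_def using assms
    by (intro summable_Gamma_quotient_power4) (auto simp: field_simps x_def, real_asymp)
  have "(\<lambda>j. \<Sum>i\<le>K. \<bar>weight (n - 2*a) j / pochhammer (x + real i) j ^ 4 * (real j + 1)\<bar>) \<longlonglongrightarrow> (\<Sum>i\<le>K. 0)"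
    using assms(1)
    by (intro tendsto_sum tendsto_rabs_zero weight_over_pochhammer_tendsto_0 x) simp
  moreover have "E = (\<lambda>j. \<Sum>i\<le>K. \<bar>weight (n - 2*a) j / pochhammer (x + real i) j ^ 4 * (real j + 1)\<bar>)"
    unfolding E_def by (simp add: abs_mult sum_distrib_left sum_distrib_right)
  ultimately have E: "E \<longlonglongrightarrow> 0" by (simp only: sum.neutral_const)
  have bound: "norm (weight (n - 2*a) j * summand a (n + real j) (b + real k)) \<le> E j * M k" for j k
  proof -
    have "Gamma (x + real k + real j) = Gamma (x + real k) * pochhammer (x + real k) j"
      using pochhammer_Gamma[OF x, of k j] x[of k] by (simp add: Gamma_eq_zero_iff)
    then have "summand a (n + real j) (b + real k)
        = (Gamma (a + b + real k) / Gamma (x + real k)) ^ 4 * (1 / pochhammer (x + real k) j ^ 4)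
          * (n + 2*b + 2 * real k + real j)"
      by (simp add: summand_def x_def power_divide power_mult_distrib algebra_simps)
    then have "norm (weight (n - 2*a) j * summand a (n + real j) (b + real k))
        = \<bar>weight (n - 2*a) j\<bar> * (1 / pochhammer (x + real k) j ^ 4)
          * (Gamma (a + b + real k) / Gamma (x + real k)) ^ 4 * \<bar>n + 2*b + 2 * real k + real j\<bar>"
      by (simp add: abs_mult)
    \<comment> \<open>The factor \<open>n+2b+2k+j\<close> mixes the variables; the product \<open>(j+1)(\<bar>n+2b+2k\<bar>+1)\<close> separates them.\<close>
    also have "\<dots> \<le> \<bar>weight (n - 2*a) j\<bar> * (\<Sum>i\<le>K. 1 / pochhammer (x + real i) j ^ 4)
          * (Gamma (a + b + real k) / Gamma (x + real k)) ^ 4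
          * ((real j + 1) * (\<bar>n + 2*b + 2 * real k\<bar> + 1))"
    proof (intro mult_mono K order_refl)
      have "\<bar>n + 2*b + 2 * real k + real j\<bar> \<le> \<bar>n + 2*b + 2 * real k\<bar> + \<bar>real j\<bar>"
        by (rule abs_triangle_ineq)
      also have "\<dots> \<le> \<bar>n + 2*b + 2 * real k\<bar> + \<bar>real j\<bar> + (real j * \<bar>n + 2*b + 2 * real k\<bar> + 1)"
        unfolding le_add_same_cancel1 by (intro add_nonneg_nonneg mult_nonneg_nonneg) simp_all
      also have "\<dots> = (real j + 1) * (\<bar>n + 2*b + 2 * real k\<bar> + 1)"
        by (simp add: distrib_left distrib_right)
      finally show "\<bar>n + 2*b + 2 * real k + real j\<bar> \<le> (real j + 1) * (\<bar>n + 2*b + 2 * real k\<bar> + 1)" .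
    qed (simp_all add: sum_nonneg)
    also have "\<dots> = E j * M k" by (simp add: E_def M_def)
    finally show ?thesis .
  qed
  have "norm (weight (n - 2*a) j * well_poised_sum a b (n + real j)) \<le> E j * suminf M" for j
  proof -
    have "summable (\<lambda>k. summand a (n + real j) (b + real k))"
      using assms nonpos_Ints_add_nat[OF assms(3), of j]
      by (intro summable_summand) (auto simp: algebra_simps)
    then have "weight (n - 2*a) j * well_poised_sum a b (n + real j)
        = (\<Sum>k. weight (n - 2*a) j * summand a (n + real j) (b + real k))"
      unfolding well_poised_sum_def by (rule suminf_mult[symmetric])
    also have "norm \<dots> \<le> (\<Sum>k. E j * M k)"
      using bound summable_mult[OF M] by (rule norm_suminf_le)
    also have "\<dots> = E j * suminf M" using M by (rule suminf_mult)
    finally show ?thesis .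
  qed
  moreover have "(\<lambda>j. E j * suminf M) \<longlonglongrightarrow> 0"
    using tendsto_mult_right[OF E, of "suminf M"] by simp
  ultimately show ?thesis
    by (rule Lim_null_comparison[OF always_eventually[OF allI]])
qed

lemma well_poised_sum_expansion:
  assumes "a < (2*n + 1) / 4" "a + b \<notin> \<int>\<^sub>\<le>\<^sub>0" "n - a + b + 1 \<notin> \<int>\<^sub>\<le>\<^sub>0"
  shows "(\<lambda>j. weight (n - 2*a) j * certificate a (n + real j) b) sums well_poised_sum a b n"
proof -
  have "(\<Sum>j<J. weight (n - 2*a) j * certificate a (n + real j) b)
      = well_poised_sum a b n - weight (n - 2*a) J * well_poised_sum a b (n + real J)" for J
    using well_poised_sum_iterated[OF assms, of J] by simp
  moreover have "(\<lambda>J. well_poised_sum a b n - weight (n - 2*a) J * well_poised_sum a b (n + real J)) \<longlonglongrightarrow> well_poised_sum a b n - 0"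
    by (intro tendsto_intros remainder_tendsto_0 assms)
  ultimately show ?thesis by (simp add: sums_def)
qed

section \<open>Translation to Pochhammer symbols of real index\<close>

text \<open>
  The symbols of index \<open>j - 1\<close> on the right-hand side are ordinary rising factorials of length
  \<open>j\<close> that start one step lower, with the first factor divided out. This covers the index \<open>-1\<close>
  at \<open>j = 0\<close>.
\<close>
lemma poch_nat_minus_1:
  assumes "x - 1 \<notin> \<int>\<^sub>\<le>\<^sub>0"
  shows "poch x (real j - 1) = pochhammer (x - 1) j / (x - 1)"
proof -
  have "Gamma x = (x - 1) * Gamma (x - 1)" using Gamma_plus1[OF assms] by simp
  moreover have shift: "x + (real j - 1) = x - 1 + real j" by simp
  ultimately show ?thesis
    using pochhammer_Gamma[OF assms, of j] unfolding poch_def shift by (simp add: mult.commute)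
qed

lemma F_eq_summand:
  "F a b n k = (Gamma (1 + n - a) / Gamma a) ^ 4 * summand a n (b + real k)"
proof -
  have "a + (real k + b) = a + (b + real k)" "1 + n - a + (real k + b) = n - a + (b + real k) + 1"
    by simp_all
  moreover have "n + 2 * real k + 2 * b = n + 2 * (b + real k)" by simp
  ultimately show ?thesis
    unfolding F_def poch_def summand_def by (simp only:) (simp add: power_divide)
qed

text \<open>
  The prefactor of \<open>R\<close> consists of the linear factors \<open>m+1\<close>, \<open>m+1/2\<close> and \<open>n-a+1\<close> that the index
  shifts divide out, together with the denominator \<open>2(2(m+j)+1)\<close> of the certificate; the
  numerator polynomial of \<open>R\<close> is \<open>cert_poly\<close> at \<open>n + j\<close>. The remaining factor
  \<open>(n-a+1)\<^sub>j\<^sup>4\<close> cancels against \<open>\<Gamma>(n-a+j+1)\<^sup>4\<close> in \<open>(n-a+j+1)\<^sub>b\<^sup>4\<close>, which leaves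
  the constant \<open>(\<Gamma>(1+n-a)/\<Gamma>(a))\<^sup>4\<close>.
\<close>
lemma series_term_eq:
  assumes "a < (2*n + 1) / 4" "1 + n - a \<notin> \<int>\<^sub>\<le>\<^sub>0"
  shows "(-1/4) ^ j
      * (poch (n - 2*a + 2) (real j - 1) ^ 5
          / (poch (n - 2*a + 3/2) (real j - 1) * poch (n - a + 2) (real j - 1) ^ 4))
      * (poch a b ^ 4 / poch (n - a + real j + 1) b ^ 4)
      * R a b n j
    = (Gamma (1 + n - a) / Gamma a) ^ 4 * (weight (n - 2*a) j * certificate a (n + real j) b)"
proof -
  define m z where "m = n - 2*a" and "z = n - a + 1"
  define p q r where "p = pochhammer (m + 1) j" and "q = pochhammer (m + 1/2) j" and "r = pochhammer z j"
  have m: "m > -1/2" using assms(1) by (simp add: m_def)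
  have z: "z \<notin> \<int>\<^sub>\<le>\<^sub>0" using assms(2) by (simp add: z_def algebra_simps)
  have nz: "m + 1 \<noteq> 0" "2*m + 1 \<noteq> 0" "z \<noteq> 0" "2*m + 2*real j + 1 \<noteq> 0" "m + 1/2 \<noteq> 0" "Gamma z \<noteq> 0"
    "r \<noteq> 0" "q \<noteq> 0"
    using m z pochhammer_pos[of "m + 1/2" j]
    by (auto simp: Gamma_eq_zero_iff r_def q_def pochhammer_eq_0_iff)
  have P: "poch (m + 2) (real j - 1) = p / (m + 1)"
    using poch_nat_minus_1[of "m + 2" j] m by (simp add: p_def nonpos_Ints_pos add.commute)
  have Q: "poch (m + 3/2) (real j - 1) = q / (m + 1/2)"
    using poch_nat_minus_1[of "m + 3/2" j] m by (simp add: q_def nonpos_Ints_pos add.commute)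
  have Rr: "poch (n - a + 2) (real j - 1) = r / z"
    using poch_nat_minus_1[of "z + 1" j] z by (simp add: r_def z_def algebra_simps)
  have Gz: "Gamma (n - a + real j + 1) = r * Gamma z"
    using pochhammer_Gamma[OF z, of j] nz by (simp add: r_def z_def algebra_simps)
  have B: "poch a b ^ 4 / poch (n - a + real j + 1) b ^ 4
      = (Gamma z / Gamma a) ^ 4 * r ^ 4 * (Gamma (a + b) / Gamma (n + real j - a + b + 1)) ^ 4"
  proof -
    have shift: "n - a + real j + 1 + b = n + real j - a + b + 1" by simp
    show ?thesis
      unfolding poch_def shift Gz by (simp add: power_divide power_mult_distrib)
  qed
  have C: "R a b n j = (m + 1)^5 / ((2*m + 1) * (2*m + 2*real j + 1) * z^4) * cert_poly a (n + real j) b"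
    by (simp add: R_def cert_poly_def m_def z_def algebra_simps power2_eq_square)
  have D: "certificate a (n + real j) b = (Gamma (a + b) / Gamma (n + real j - a + b + 1)) ^ 4
      * cert_poly a (n + real j) b / (2 * (2*m + 2*real j + 1))"
    by (simp add: certificate_def m_def algebra_simps)
  define g c where "g = (Gamma (a + b) / Gamma (n + real j - a + b + 1)) ^ 4" and "c = cert_poly a (n + real j) b"
  define d where "d = 2*m + 2*real j + 1"
  have "1 + n - a = z" by (simp add: z_def)
  have half: "m + 1/2 = (2*m + 1) / 2" by simp
  have main: "(p / (m + 1)) ^ 5 / (q / (m + 1/2) * (r / z) ^ 4) * r ^ 4 * g
      * ((m + 1)^5 / ((2*m + 1) * d * z^4) * c) = p ^ 5 / q * (g * c / (2 * d))"
    using nz unfolding half by (simp add: power_divide d_def[symmetric])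
  \<comment> \<open>Moves the constant \<open>k\<close> out of the product and the power \<open>s\<close> of \<open>-1/4\<close> into the weight.\<close>
  have regroup: "s * A * (k * r' * g) * (B * c) = k * (s * P / q * E)"
    if "A * r' * g * (B * c) = P / q * E" for s A k r' B P E :: real
  proof -
    have "s * A * (k * r' * g) * (B * c) = s * k * (A * r' * g * (B * c))" by (simp only: mult_ac)
    then show ?thesis unfolding that by simp
  qed
  show ?thesis
    unfolding P Q Rr B C D weight_def \<open>1 + n - a = z\<close> m_def[symmetric]
      p_def[symmetric] q_def[symmetric] g_def[symmetric] c_def[symmetric] d_def[symmetric]
    by (rule regroup) (rule main)
qed

theorem theorem1:
  fixes a b n :: real
  assumes "a < (2*n + 1) / 4"
    and "\<And>k::nat. poch_defined a (real k + b)"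
    and "\<And>k::nat. poch_defined (1 + n - a) (real k + b)"
  shows "summable (F a b n) \<and>
    (\<lambda>j::nat.
      (-1/4) ^ j
      * (poch (n - 2*a + 2) (real j - 1) ^ 5
          / (poch (n - 2*a + 3/2) (real j - 1) * poch (n - a + 2) (real j - 1) ^ 4))
      * (poch a b ^ 4 / poch (n - a + real j + 1) b ^ 4)
      * R a b n j)
    sums (\<Sum>k. F a b n k)"
proof -
  let ?C = "(Gamma (1 + n - a) / Gamma a) ^ 4"
  have ab: "a + b \<notin> \<int>\<^sub>\<le>\<^sub>0"
    using assms(2)[of 0] by (simp add: poch_defined_def)
  have nab: "1 + n - a \<notin> \<int>\<^sub>\<le>\<^sub>0" "n - a + b + 1 \<notin> \<int>\<^sub>\<le>\<^sub>0"
    using assms(3)[of 0] by (auto simp: poch_defined_def algebra_simps)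
  have F: "F a b n = (\<lambda>k. ?C * summand a n (b + real k))"
    by (rule ext) (rule F_eq_summand)
  have summable: "summable (\<lambda>k. summand a n (b + real k))"
    by (rule summable_summand) fact+
  then have "suminf (F a b n) = ?C * well_poised_sum a b n"
    unfolding F well_poised_sum_def by (rule suminf_mult)
  moreover have "(\<lambda>j. ?C * (weight (n - 2*a) j * certificate a (n + real j) b)) sums (?C * well_poised_sum a b n)"
    by (intro sums_mult well_poised_sum_expansion assms(1) ab nab)
  moreover have "summable (F a b n)"
    unfolding F using summable by (rule summable_mult)
  ultimately show ?thesis
    unfolding series_term_eq[OF assms(1) nab(1)] by simp
qed

end
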